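(* (1) Let $F=(\mathbf{X},R)$ be a W-forest frame. Then $\mathbf{G}(F)=(\mathbf{G}(\mathbf{X}),\beta_R,\delta_R)$ is a W-GAO. (2) Let $(\mathbf{A},\Box,\Diamond)$ be a finite W-GAO. Then $(\mathbf{F}_{\mathbf{A}},R_{\mathbf{A}})$ is a W-forest frame.
   Context: A G\"odel algebra is a Heyting algebra $\mathbf{A}=(A,\wedge,\vee,\to,\bot,\top)$ satisfying prelinearity $(a\to b)\vee(b\to a)=\top$; $\neg x=x\to\bot$. A GAO (G\"odel algebra with operators) is a triple $(\mathbf{A},\Box,\Diamond)$ with $\mathbf{A}$ a G\"odel algebra and $\Box,\Diamond:A\to A$ satisfying $\Box\top=\top$, $\Box(x\wedge y)=\Box x\wedge\Box y$, $\Diamond\bot=\bot$, $\Diamond(x\vee y)=\Diamond x\vee\Diamond y$. A Dunn GAO is a GAO satisfying, for all $a,b$: $\Box(a\vee b)\leq\Box a\vee\Diamond b$ and $\Box a\wedge\Diamond b\leq\Diamond(a\wedge b)$. A W-GAO is a Dunn GAO satisfying, for all $x$, $\Box x\vee\neg\Box x=\top$ and $\Diamond x\vee\neg\Diamond x=\top$. A forest is a finite poset in which the downset of each element is totally ordered. Composition of relations: $x(S\circ T)y$ iff there is $z$ with $xSz$ and $zTy$. A W-forest frame is a pair $(\mathbf{X},R)$ where $\mathbf{X}=(X,\leq)$ is a (finite) forest and $R\subseteq X\times X$ satisfies $(\leq\circ R)\subseteq R$ and $(\geq\circ R)\subseteq R$. For a forest $\mathbf{X}=(X,\leq)$, $G(\mathbf{X})$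 is the set of all downward closed subsets of $X$, and $\mathbf{G}(\mathbf{X})=(G(\mathbf{X}),\cap,\cup,\to,\emptyset,X)$ with $x\to y=X\setminus{\uparrow}(x\setminus y)$, which is a G\"odel algebra. For $a\in G(\mathbf{X})$: $\beta_R(a)=\{y\in X\mid\forall z\in X,\ (yRz\Rightarrow z\in a)\}$ and $\delta_R(a)=\{y\in X\mid\exists z\in a,\ yRz\}$. For a finite GAO $(\mathbf{A},\Box,\Diamond)$, $F_{\mathbf{A}}$ is the set of prime (proper) filters of $\mathbf{A}$, ordered by $f_1\leq f_2$ iff $f_1\supseteq f_2$; $\mathbf{F}_{\mathbf{A}}=(F_{\mathbf{A}},\leq)$; and $fR_{\mathbf{A}}g$ iff $\Box^{-1}(f)\subseteq g\subseteq\Diamond^{-1}(f)$. *)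

theory Defs
  imports "HOL-Algebra.Congruence"
begin

section \<open>Goedel algebras with operators\<close>

record 'a heyting_sig = "'a partial_object" +
  hmeet :: "'a \<Rightarrow> 'a \<Rightarrow> 'a" (infixl "\<sqinter>\<index>" 70)
  hjoin :: "'a \<Rightarrow> 'a \<Rightarrow> 'a" (infixl "\<squnion>\<index>" 65)
  himp  :: "'a \<Rightarrow> 'a \<Rightarrow> 'a" (infixr "\<leadsto>\<index>" 60)
  hbot  :: 'a ("\<bottom>\<index>")
  htop  :: 'a ("\<top>\<index>")

definition hle :: "('a, 'm) heyting_sig_scheme \<Rightarrow> 'a \<Rightarrow> 'a \<Rightarrow> bool" (infix "\<sqsubseteq>\<index>" 50)
  where "x \<sqsubseteq>\<^bsub>A\<^esub> y \<longleftrightarrow> x \<sqinter>\<^bsub>A\<^esub> y = x"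

definition hneg :: "('a, 'm) heyting_sig_scheme \<Rightarrow> 'a \<Rightarrow> 'a" ("\<sim>\<index> _" [81] 80)
  where "\<sim>\<^bsub>A\<^esub> x = (x \<leadsto>\<^bsub>A\<^esub> \<bottom>\<^bsub>A\<^esub>)"

text \<open>Distributivity is not listed, as it follows from residuation.  The one-element algebra
  is allowed.\<close>

locale heyting_algebra =
  fixes A :: "('a, 'm) heyting_sig_scheme" (structure)
  assumes meet_closed: "\<lbrakk>x \<in> carrier A; y \<in> carrier A\<rbrakk> \<Longrightarrow> x \<sqinter> y \<in> carrier A"
    and join_closed: "\<lbrakk>x \<in> carrier A; y \<in> carrier A\<rbrakk> \<Longrightarrow> x \<squnion> y \<in> carrier A"
    and imp_closed: "\<lbrakk>x \<in> carrier A; y \<in> carrier A\<rbrakk> \<Longrightarrow> x \<leadsto> y \<in> carrier A"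
    and bot_closed: "\<bottom> \<in> carrier A"
    and top_closed: "\<top> \<in> carrier A"
    and meet_comm: "\<lbrakk>x \<in> carrier A; y \<in> carrier A\<rbrakk> \<Longrightarrow> x \<sqinter> y = y \<sqinter> x"
    and join_comm: "\<lbrakk>x \<in> carrier A; y \<in> carrier A\<rbrakk> \<Longrightarrow> x \<squnion> y = y \<squnion> x"
    and meet_assoc: "\<lbrakk>x \<in> carrier A; y \<in> carrier A; z \<in> carrier A\<rbrakk>
      \<Longrightarrow> (x \<sqinter> y) \<sqinter> z = x \<sqinter> (y \<sqinter> z)"
    and join_assoc: "\<lbrakk>x \<in> carrier A; y \<in> carrier A; z \<in> carrier A\<rbrakk>
      \<Longrightarrow> (x \<squnion> y) \<squnion> z = x \<squnion> (y \<squnion> z)"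
    and meet_join_absorb: "\<lbrakk>x \<in> carrier A; y \<in> carrier A\<rbrakk> \<Longrightarrow> x \<sqinter> (x \<squnion> y) = x"
    and join_meet_absorb: "\<lbrakk>x \<in> carrier A; y \<in> carrier A\<rbrakk> \<Longrightarrow> x \<squnion> (x \<sqinter> y) = x"
    and bot_least: "x \<in> carrier A \<Longrightarrow> \<bottom> \<sqsubseteq> x"
    and top_greatest: "x \<in> carrier A \<Longrightarrow> x \<sqsubseteq> \<top>"
    and residuation: "\<lbrakk>x \<in> carrier A; y \<in> carrier A; z \<in> carrier A\<rbrakk>
      \<Longrightarrow> (z \<sqinter> x \<sqsubseteq> y) \<longleftrightarrow> (z \<sqsubseteq> x \<leadsto> y)"

locale goedel_algebra = heyting_algebra +
  assumes prelinearity: "\<lbrakk>x \<in> carrier A; y \<in> carrier A\<rbrakk> \<Longrightarrow> (x \<leadsto> y) \<squnion> (y \<leadsto> x) = \<top>"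

locale GAO = goedel_algebra +
  fixes Box Dia :: "'a \<Rightarrow> 'a"
  assumes Box_closed: "x \<in> carrier A \<Longrightarrow> Box x \<in> carrier A"
    and Dia_closed: "x \<in> carrier A \<Longrightarrow> Dia x \<in> carrier A"
    and Box_top: "Box \<top> = \<top>"
    and Box_meet: "\<lbrakk>x \<in> carrier A; y \<in> carrier A\<rbrakk> \<Longrightarrow> Box (x \<sqinter> y) = Box x \<sqinter> Box y"
    and Dia_bot: "Dia \<bottom> = \<bottom>"
    and Dia_join: "\<lbrakk>x \<in> carrier A; y \<in> carrier A\<rbrakk> \<Longrightarrow> Dia (x \<squnion> y) = Dia x \<squnion> Dia y"

locale Dunn_GAO = GAO +
  assumes Box_join_le: "\<lbrakk>x \<in> carrier A; y \<in> carrier A\<rbrakk> \<Longrightarrow> Box (x \<squnion> y) \<sqsubseteq> Box x \<squnion> Dia y"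
    and Box_meet_Dia_le: "\<lbrakk>x \<in> carrier A; y \<in> carrier A\<rbrakk> \<Longrightarrow> Box x \<sqinter> Dia y \<sqsubseteq> Dia (x \<sqinter> y)"

locale W_GAO = Dunn_GAO +
  assumes Box_complemented: "x \<in> carrier A \<Longrightarrow> Box x \<squnion> (\<sim> Box x) = \<top>"
    and Dia_complemented: "x \<in> carrier A \<Longrightarrow> Dia x \<squnion> (\<sim> Dia x) = \<top>"

section \<open>Forest frames\<close>

text \<open>A poset is a carrier \<open>X\<close> with a relation \<open>le\<close>, where \<open>(x, y) \<in> le\<close> means \<open>x \<le> y\<close>.
  The empty forest is allowed.\<close>

definition forest :: "'x set \<Rightarrow> 'x rel \<Rightarrow> bool" where
  "forest X le \<longleftrightarrow> finite X \<and> partial_order_on X le \<and>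
    (\<forall>x\<in>X. total_on {y \<in> X. (y, x) \<in> le} le)"

definition W_forest_frame :: "'x set \<Rightarrow> 'x rel \<Rightarrow> 'x rel \<Rightarrow> bool" where
  "W_forest_frame X le R \<longleftrightarrow>
    forest X le \<and> R \<subseteq> X \<times> X \<and> le O R \<subseteq> R \<and> le\<inverse> O R \<subseteq> R"

section \<open>From frames to algebras\<close>

definition downsets :: "'x set \<Rightarrow> 'x rel \<Rightarrow> 'x set set" where
  "downsets X le = {a. a \<subseteq> X \<and> (\<forall>x\<in>a. \<forall>y\<in>X. (y, x) \<in> le \<longrightarrow> y \<in> a)}"

text \<open>The image \<open>le `` s\<close> is the upward closure of \<open>s\<close>.\<close>

definition downset_algebra :: "'x set \<Rightarrow> 'x rel \<Rightarrow> 'x set heyting_sig" where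
  "downset_algebra X le =
    \<lparr>carrier = downsets X le, hmeet = (\<inter>), hjoin = (\<union>),
     himp = (\<lambda>a b. X - le `` (a - b)), hbot = {}, htop = X\<rparr>"

definition frame_box :: "'x set \<Rightarrow> 'x rel \<Rightarrow> 'x set \<Rightarrow> 'x set" where
  "frame_box X R a = {y \<in> X. \<forall>z\<in>X. (y, z) \<in> R \<longrightarrow> z \<in> a}"

definition frame_dia :: "'x set \<Rightarrow> 'x rel \<Rightarrow> 'x set \<Rightarrow> 'x set" where
  "frame_dia X R a = {y \<in> X. \<exists>z\<in>a. (y, z) \<in> R}"

section \<open>From algebras to frames\<close>

definition lattice_filter :: "('a, 'm) heyting_sig_scheme \<Rightarrow> 'a set \<Rightarrow> bool" where
  "lattice_filter A f \<longleftrightarrow> f \<subseteq> carrier A \<and> f \<noteq> {} \<and>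
    (\<forall>x\<in>f. \<forall>y\<in>f. x \<sqinter>\<^bsub>A\<^esub> y \<in> f) \<and>
    (\<forall>x\<in>f. \<forall>y\<in>carrier A. x \<sqsubseteq>\<^bsub>A\<^esub> y \<longrightarrow> y \<in> f)"

definition prime_filter :: "('a, 'm) heyting_sig_scheme \<Rightarrow> 'a set \<Rightarrow> bool" where
  "prime_filter A f \<longleftrightarrow> lattice_filter A f \<and> f \<noteq> carrier A \<and>
    (\<forall>x\<in>carrier A. \<forall>y\<in>carrier A. x \<squnion>\<^bsub>A\<^esub> y \<in> f \<longrightarrow> x \<in> f \<or> y \<in> f)"

definition prime_filters :: "('a, 'm) heyting_sig_scheme \<Rightarrow> 'a set set" where
  "prime_filters A = {f. prime_filter A f}"

text \<open>Prime filters are ordered by reverse inclusion.\<close>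

definition prime_filter_order :: "('a, 'm) heyting_sig_scheme \<Rightarrow> 'a set rel" where
  "prime_filter_order A = {(f, g) \<in> prime_filters A \<times> prime_filters A. f \<supseteq> g}"

text \<open>The intersections with \<open>carrier A\<close> form the preimages under the operators as maps
  \<open>carrier A \<rightarrow> carrier A\<close>; their values outside the carrier play no role.\<close>

definition prime_filter_rel ::
    "('a, 'm) heyting_sig_scheme \<Rightarrow> ('a \<Rightarrow> 'a) \<Rightarrow> ('a \<Rightarrow> 'a) \<Rightarrow> 'a set rel" where
  "prime_filter_rel A Box Dia = {(f, g) \<in> prime_filters A \<times> prime_filters A.
     Box -` f \<inter> carrier A \<subseteq> g \<and> g \<subseteq> Dia -` f \<inter> carrier A}"

end

theory Submission
  imports Defs
begin

text \<open>Two comparable prime filters contain the same complemented elements, in particular the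
  same \<open>\<box>x\<close> and \<open>\<diamond>x\<close>, so \<open>R\<close> does not distinguish comparable sources.
  Dually, in a W-forest frame comparable points have the same \<open>R\<close>-successors, so that the values of \<open>\<beta>\<close> and \<open>\<delta>\<close> are both upward and downward
  closed, hence complemented among the downsets. Prelinearity corresponds to the forest property
  in both directions.\<close>

section \<open>Downset algebras\<close>

lemma forest_le_subset: "forest X le \<Longrightarrow> le \<subseteq> X \<times> X"
  by (auto simp: forest_def partial_order_on_def preorder_on_def)

lemma forest_refl: "forest X le \<Longrightarrow> x \<in> X \<Longrightarrow> (x, x) \<in> le"
  by (auto simp: forest_def partial_order_on_def preorder_on_def refl_on_def)

lemma forest_trans: "forest X le \<Longrightarrow> (x, y) \<in> le \<Longrightarrow> (y, z) \<in> le \<Longrightarrow> (x, z) \<in> le"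
  unfolding forest_def partial_order_on_def preorder_on_def by (meson transD)

lemma forest_comparable:
  assumes "forest X le" "(x, z) \<in> le" "(y, z) \<in> le"
  shows "(x, y) \<in> le \<or> (y, x) \<in> le"
proof -
  have "x \<in> X" "y \<in> X" "z \<in> X"
    using forest_le_subset[OF assms(1)] assms(2,3) by auto
  with assms show ?thesis
    \<comment> \<open>\<open>total_on\<close> compares distinct points only; reflexivity settles
      \<open>x = y\<close>.\<close>
    using forest_refl[OF assms(1)] unfolding forest_def total_on_def
    by (cases "x = y") auto
qed

lemma downset_imp_closed:
  assumes "forest X le"
  shows "X - le `` s \<in> downsets X le"
  unfolding downsets_def using forest_trans[OF assms] by blast

text \<open>If a point of \<open>c\<close> lies above some \<open>x\<close> in \<open>a - b\<close>,
  then \<open>x\<close> is in \<open>c\<close> too, against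
  \<open>c \<inter> a \<subseteq> b\<close>. Conversely, reflexivity puts \<open>a - b\<close>
  inside its own upward closure.\<close>

lemma downset_residuation:
  assumes "forest X le" "a \<in> downsets X le" "b \<in> downsets X le" "c \<in> downsets X le"
  shows "c \<inter> a \<subseteq> b \<longleftrightarrow> c \<subseteq> X - le `` (a - b)"
proof
  assume "c \<inter> a \<subseteq> b"
  then show "c \<subseteq> X - le `` (a - b)"
    using assms(2,4) unfolding downsets_def by blast
next
  assume "c \<subseteq> X - le `` (a - b)"
  then show "c \<inter> a \<subseteq> b"
    using forest_refl[OF assms(1)] by blast
qed

lemma downset_algebra_goedel:
  assumes "forest X le"
  shows "goedel_algebra (downset_algebra X le)"
proof
  fix a b
  assume ab: "a \<in> carrier (downset_algebra X le)" "b \<in> carrier (downset_algebra X le)"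
  then have dn: "a \<in> downsets X le" "b \<in> downsets X le"
    by (simp_all add: downset_algebra_def)
  have "X \<subseteq> (X - le `` (a - b)) \<union> (X - le `` (b - a))"
  proof
    fix z assume "z \<in> X"
    show "z \<in> (X - le `` (a - b)) \<union> (X - le `` (b - a))"
    \<comment> \<open>A point missing from both implications lies above some \<open>x\<close> in
      \<open>a - b\<close> and some \<open>y\<close> in \<open>b - a\<close>. These are comparable
      in a forest, and the lower one then belongs to both downsets.\<close>
    proof (rule ccontr)
      assume "z \<notin> (X - le `` (a - b)) \<union> (X - le `` (b - a))"
      with \<open>z \<in> X\<close> obtain x y where
        xy: "(x, z) \<in> le" "(y, z) \<in> le" "x \<in> a" "x \<notin> b" "y \<in> b" "y \<notin> a"
        by blast
      with forest_comparable[OF assms xy(1,2)] dn show False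
        unfolding downsets_def by blast
    qed
  qed
  then show "(a \<leadsto>\<^bsub>downset_algebra X le\<^esub> b) \<squnion>\<^bsub>downset_algebra X le\<^esub> (b \<leadsto>\<^bsub>downset_algebra X le\<^esub> a)
      = \<top>\<^bsub>downset_algebra X le\<^esub>"
    by (auto simp: downset_algebra_def)
next
  fix a b c
  assume "a \<in> carrier (downset_algebra X le)" "b \<in> carrier (downset_algebra X le)"
    "c \<in> carrier (downset_algebra X le)"
  then show "(c \<sqinter>\<^bsub>downset_algebra X le\<^esub> a \<sqsubseteq>\<^bsub>downset_algebra X le\<^esub> b)
      \<longleftrightarrow> (c \<sqsubseteq>\<^bsub>downset_algebra X le\<^esub> a \<leadsto>\<^bsub>downset_algebra X le\<^esub> b)"
    using downset_residuation[OF assms, of a b c]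
    by (simp add: downset_algebra_def hle_def Int_absorb2 inf.absorb_iff1)
next
  fix a b
  show "a \<leadsto>\<^bsub>downset_algebra X le\<^esub> b \<in> carrier (downset_algebra X le)"
    using downset_imp_closed[OF assms] by (simp add: downset_algebra_def)
qed (auto simp: downset_algebra_def downsets_def hle_def)

text \<open>The condition on \<open>le O R\<close> carries successors from \<open>y\<close> down to
  \<open>x\<close>, the one on \<open>le\<inverse> O R\<close> from \<open>x\<close> up to
  \<open>y\<close>.\<close>

lemma W_forest_frame_rel_cong:
  assumes "W_forest_frame X le R" "(x, y) \<in> le"
  shows "(x, z) \<in> R \<longleftrightarrow> (y, z) \<in> R"
  using assms unfolding W_forest_frame_def by blast

lemma downset_algebra_complemented:
  assumes "a \<subseteq> X" "\<And>x y. (x, y) \<in> le \<Longrightarrow> x \<in> a \<longleftrightarrow> y \<in> a"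
  shows "a \<squnion>\<^bsub>downset_algebra X le\<^esub> (\<sim>\<^bsub>downset_algebra X le\<^esub> a) = \<top>\<^bsub>downset_algebra X le\<^esub>"
  using assms by (auto simp: downset_algebra_def hneg_def)

lemma frame_operators_cong:
  assumes "W_forest_frame X le R" "(x, y) \<in> le"
  shows "x \<in> frame_box X R a \<longleftrightarrow> y \<in> frame_box X R a"
    and "x \<in> frame_dia X R a \<longleftrightarrow> y \<in> frame_dia X R a"
proof -
  have "x \<in> X" "y \<in> X"
    using assms forest_le_subset unfolding W_forest_frame_def by blast+
  with W_forest_frame_rel_cong[OF assms]
  show "x \<in> frame_box X R a \<longleftrightarrow> y \<in> frame_box X R a"
    and "x \<in> frame_dia X R a \<longleftrightarrow> y \<in> frame_dia X R a"
    by (simp_all add: frame_box_def frame_dia_def)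
qed

lemma downset_algebra_W_GAO:
  assumes "W_forest_frame X le R"
  shows "W_GAO (downset_algebra X le) (frame_box X R) (frame_dia X R)"
proof -
  interpret goedel_algebra "downset_algebra X le"
    using assms by (simp add: W_forest_frame_def downset_algebra_goedel)
  have sub: "frame_box X R a \<subseteq> X" "frame_dia X R a \<subseteq> X" for a
    by (auto simp: frame_box_def frame_dia_def)
  have closed: "frame_box X R a \<in> carrier (downset_algebra X le)"
    "frame_dia X R a \<in> carrier (downset_algebra X le)" for a
    using frame_operators_cong[OF assms] sub
    unfolding downset_algebra_def downsets_def by auto
  note compl = downset_algebra_complemented[OF sub(1) frame_operators_cong(1)[OF assms]]
    downset_algebra_complemented[OF sub(2) frame_operators_cong(2)[OF assms]]
  \<comment> \<open>The Dunn inequalities hold pointwise. If all successors of a point lie in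
    \<open>a \<union> b\<close>, then all lie in \<open>a\<close> or one lies in \<open>b\<close>;
    if all lie in \<open>a\<close> and one in \<open>b\<close>, that one lies in
    \<open>a \<inter> b\<close>.\<close>
  show ?thesis
    by unfold_locales
      (simp_all add: closed compl,
       auto simp: downset_algebra_def downsets_def hle_def frame_box_def frame_dia_def)
qed

section \<open>Prime filters\<close>

lemma prime_filterD:
  assumes "prime_filter A f"
  shows prime_filter_subset: "f \<subseteq> carrier A"
    and prime_filter_meet: "x \<in> f \<Longrightarrow> y \<in> f \<Longrightarrow> x \<sqinter>\<^bsub>A\<^esub> y \<in> f"
    and prime_filter_up: "x \<in> f \<Longrightarrow> y \<in> carrier A \<Longrightarrow> x \<sqsubseteq>\<^bsub>A\<^esub> y \<Longrightarrow> y \<in> f"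
    and prime_filter_join:
      "x \<in> carrier A \<Longrightarrow> y \<in> carrier A \<Longrightarrow> x \<squnion>\<^bsub>A\<^esub> y \<in> f \<Longrightarrow> x \<in> f \<or> y \<in> f"
  using assms unfolding prime_filter_def lattice_filter_def by blast+

context heyting_algebra
begin

text \<open>The two absorption laws combine to give idempotence, which is reflexivity of
  \<open>hle\<close>.\<close>

lemma meet_idem:
  assumes "x \<in> carrier A"
  shows "x \<sqinter> x = x"
  using assms meet_join_absorb[of x "x \<sqinter> x"] join_meet_absorb[of x x] meet_closed by simp

text \<open>Residuation at \<open>z = x \<leadsto> y\<close> turns reflexivity of \<open>hle\<close>
  into this inequality.\<close>

lemma modus_ponens:
  assumes "x \<in> carrier A" "y \<in> carrier A"
  shows "(x \<leadsto> y) \<sqinter> x \<sqsubseteq> y"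
  using assms residuation[of x y "x \<leadsto> y"] imp_closed meet_idem by (simp add: hle_def)

lemma prime_filter_top: "prime_filter A f \<Longrightarrow> \<top> \<in> f"
  using top_greatest top_closed unfolding prime_filter_def lattice_filter_def by blast

lemma prime_filter_bot: "prime_filter A f \<Longrightarrow> \<bottom> \<notin> f"
  using bot_least unfolding prime_filter_def lattice_filter_def by blast

lemma prime_filter_mp:
  assumes "prime_filter A f" "x \<leadsto> y \<in> f" "x \<in> f" "y \<in> carrier A"
  shows "y \<in> f"
proof -
  have "x \<in> carrier A"
    using assms prime_filter_subset by blast
  then show ?thesis
    using assms prime_filter_meet prime_filter_up modus_ponens by metis
qed

text \<open>Primeness of the smaller filter \<open>g\<close> makes it contain \<open>x\<close> or
  \<open>\<sim> x\<close>. When \<open>x \<in> f\<close>, the second case would put both into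
  \<open>f\<close>, and hence \<open>\<bottom>\<close>.\<close>

lemma complemented_mem_prime_filter_iff:
  assumes "prime_filter A f" "prime_filter A g" "g \<subseteq> f"
    and x: "x \<in> carrier A" "x \<squnion> (\<sim> x) = \<top>"
  shows "x \<in> f \<longleftrightarrow> x \<in> g"
proof
  assume "x \<in> f"
  have "x \<in> g \<or> \<sim> x \<in> g"
    using prime_filter_join[OF assms(2), of x "\<sim> x"] prime_filter_top[OF assms(2)] x
      imp_closed bot_closed by (simp add: hneg_def)
  moreover have "\<sim> x \<notin> f"
    using prime_filter_mp[OF assms(1) _ \<open>x \<in> f\<close> bot_closed] prime_filter_bot[OF assms(1)]
    by (auto simp: hneg_def)
  ultimately show "x \<in> g"
    using assms(3) by blast
qed (use assms(3) in blast)

end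

context goedel_algebra
begin

text \<open>For \<open>x\<close> in \<open>g - h\<close> and \<open>y\<close> in
  \<open>h - g\<close>, prelinearity and primeness put \<open>x \<leadsto> y\<close> or
  \<open>y \<leadsto> x\<close> into \<open>f\<close>. Modus ponens then forces \<open>y\<close>
  into \<open>g\<close> or \<open>x\<close> into \<open>h\<close>.\<close>

lemma prime_filters_above_chain:
  assumes "prime_filter A f" "prime_filter A g" "prime_filter A h" "f \<subseteq> g" "f \<subseteq> h"
  shows "g \<subseteq> h \<or> h \<subseteq> g"
proof (rule ccontr)
  assume "\<not> (g \<subseteq> h \<or> h \<subseteq> g)"
  then obtain x y where xy: "x \<in> g" "x \<notin> h" "y \<in> h" "y \<notin> g"
    by blast
  then have car: "x \<in> carrier A" "y \<in> carrier A"
    using assms prime_filter_subset by blast+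
  then have "x \<leadsto> y \<in> f \<or> y \<leadsto> x \<in> f"
    using prime_filter_join[OF assms(1), of "x \<leadsto> y" "y \<leadsto> x"] prelinearity
      prime_filter_top[OF assms(1)] imp_closed by simp
  then show False
    using prime_filter_mp assms xy car by blast
qed

lemma prime_filters_forest:
  assumes "finite (carrier A)"
  shows "forest (prime_filters A) (prime_filter_order A)"
proof -
  have "prime_filters A \<subseteq> Pow (carrier A)"
    using prime_filter_subset by (auto simp: prime_filters_def)
  then have "finite (prime_filters A)"
    using assms finite_subset by blast
  moreover have "partial_order_on (prime_filters A) (prime_filter_order A)"
    unfolding partial_order_on_def preorder_on_def prime_filter_order_def
    by (auto simp: refl_on_def trans_def antisym_def)
  \<comment> \<open>The order reverses inclusion, so the downset of \<open>f\<close> consists of the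
    prime filters containing \<open>f\<close>.\<close>
  moreover have "total_on {g \<in> prime_filters A. (g, f) \<in> prime_filter_order A}
      (prime_filter_order A)" for f
    unfolding total_on_def prime_filter_order_def prime_filters_def
    using prime_filters_above_chain by auto
  ultimately show ?thesis
    by (simp add: forest_def)
qed

end

context W_GAO
begin

lemma prime_filter_rel_cong:
  assumes "prime_filter A f" "prime_filter A g" "g \<subseteq> f"
  shows "(f, h) \<in> prime_filter_rel A Box Dia \<longleftrightarrow> (g, h) \<in> prime_filter_rel A Box Dia"
proof -
  have "Box x \<in> f \<longleftrightarrow> Box x \<in> g" "Dia x \<in> f \<longleftrightarrow> Dia x \<in> g" if "x \<in> carrier A" for x
    using complemented_mem_prime_filter_iff[OF assms] that
      Box_closed Dia_closed Box_complemented Dia_complemented by auto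
  \<comment> \<open>The relation depends on its source only through these two preimages.\<close>
  then have "Box -` f \<inter> carrier A = Box -` g \<inter> carrier A"
    "Dia -` f \<inter> carrier A = Dia -` g \<inter> carrier A"
    by auto
  then show ?thesis
    using assms by (auto simp: prime_filter_rel_def prime_filters_def)
qed

lemma prime_filters_W_forest_frame:
  assumes "finite (carrier A)"
  shows "W_forest_frame (prime_filters A) (prime_filter_order A) (prime_filter_rel A Box Dia)"
proof -
  let ?le = "prime_filter_order A" and ?R = "prime_filter_rel A Box Dia"
  \<comment> \<open>Read from right to left this gives the inclusion for \<open>?le O ?R\<close>,
    from left to right the one for \<open>?le\<inverse> O ?R\<close>.\<close>
  have cong: "(f, h) \<in> ?R \<longleftrightarrow> (g, h) \<in> ?R" if "(f, g) \<in> ?le" for f g h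
    using that prime_filter_rel_cong by (auto simp: prime_filter_order_def prime_filters_def)
  then have "?le O ?R \<subseteq> ?R" "?le\<inverse> O ?R \<subseteq> ?R"
    by auto
  moreover have "?R \<subseteq> prime_filters A \<times> prime_filters A"
    by (auto simp: prime_filter_rel_def)
  ultimately show ?thesis
    using prime_filters_forest[OF assms] by (simp add: W_forest_frame_def)
qed

end

theorem theorem6p18:
  fixes X :: "'x set" and le R :: "'x rel"
    and A :: "('a, 'm) heyting_sig_scheme" and Box Dia :: "'a \<Rightarrow> 'a"
  shows "(W_forest_frame X le R \<longrightarrow>
            W_GAO (downset_algebra X le) (frame_box X R) (frame_dia X R)) \<and>
         (W_GAO A Box Dia \<and> finite (carrier A) \<longrightarrow>
            W_forest_frame (prime_filters A) (prime_filter_order A) (prime_filter_rel A Box Dia))"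
  using downset_algebra_W_GAO W_GAO.prime_filters_W_forest_frame by blast

end
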